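(* Let $k\geq 2$ be an integer. Suppose a system $(\mathcal V,\mathbf c,\boldsymbol\mu)$ (for this $k$), with $\mathcal V=(V_0,\ldots,V_r)$ and endpoint $b=c_{r+1}$, satisfies the weak entropy condition. Then for every $\varepsilon>0$, the flag $\mathcal V$ admits a complete refinement $\mathcal V'$ supporting a system $(\mathcal V',\mathbf c',\boldsymbol\mu')$ (that is, a system whose underlying flag is $\mathcal V'$) that satisfies the strict entropy condition and has endpoint greater than $b-\varepsilon$. Consequently $\widetilde\gamma_k=\gamma_k$.
   Context: Fix an integer $k\geq 2$. Logarithms are natural. Write $Q_k=\{0,1\}^k$, regarded as a subset of $\mathbb Q^k$, and $\mathbf 1=(1,\ldots,1)$. Flags. An $r$-step flag is a nested sequence $\mathcal V=(V_0,\ldots,V_r)$ of rational subspaces (that is, $\mathbb Q$-linear subspaces of $\mathbb Q^k$) with $\mathbb Q\mathbf 1=V_0\leq V_1\leq\cdots\leq V_r\leq\mathbb Q^k$; inclusions need not be strict. The flag is complete if $\dim V_j=\dim V_{j-1}+1$ for every $1\leq j\leq r$. A refinement of a flag $\mathcal V$ is a flag obtained by inserting further subspaces between consecutive members of $\mathcal V$; in particular every $V_j$ is a member of the refinement, and the initial and terminal spaces are unchanged. Systems. A system is a triple $(\mathcal V,\mathbf c,\boldsymbol\mu)$ such that: (a) $\mathcal V=(V_0,\ldots,V_r)$ is an $r$-step flag whose members $V_j$ are distinct and are each spanned by elements of $Q_k$; (b) $\mathcal V$ is nondegenerate, meaning that $V_r$ is not contained in any of the subspaces $\{v\in\mathbb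 Q^k: v_s=v_t\}$ with $s\neq t$; (c) $\mathbf c=(c_1,\ldots,c_{r+1})$ is a tuple of real numbers with $1\geq c_1\geq\cdots\geq c_{r+1}\geq 0$; (d) $\boldsymbol\mu=(\mu_1,\ldots,\mu_r)$ is an $r$-tuple of probability measures on $Q_k$; (e) $\operatorname{supp}\mu_j\subseteq V_j\cap Q_k$ for every $1\leq j\leq r$. The number $c_{r+1}$ is called the endpoint of the system. Subflags. A subflag $\mathcal W\leq\mathcal V$ is a sequence of rational subspaces $W_0=\mathbb Q\mathbf 1\leq W_1\leq\cdots\leq W_r$ such that $W_j\subseteq V_j$ for every $j=0,\ldots,r$. Its inclusions need not be strict and its spaces need not be spanned by elements of $Q_k$. Entropy and energy. For a probability measure $\mu$ on $Q_k$ and a rational subspace $W\subseteq\mathbb Q^k$, each coset $C$ of $W$ has mass $\mu(C)=\sum_{\omega\in C\cap Q_k}\mu(\omega)$, and $$H_\mu(W)=-\sum_{C\in\mathbb Q^k/W}\mu(C)\log\mu(C),\qquad 0\log 0=0.$$ The energy of a subflag $\mathcal W\leq\mathcal V$ is $$e_{\mathbf c,\boldsymbol\mu}(\mathcal W)=\sum_{j=1}^r(c_j-c_{j+1})H_{\mu_j}(W_j)+\sum_{j=1}^r c_j\dim(W_j/W_{j-1}).$$ Entropy conditions. The system satisfies the weak entropy condition if $e_{\mathbf c,\boldsymbol\mu}(\mathcal W)\geq e_{\mathbf c,\boldsymbol\mu}(\mathcal V)$ for every subflag $\mathcal W\leq\mathcal V$. It satisfies the strict entropy condition if $e_{\mathbf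 c,\boldsymbol\mu}(\mathcal W)> e_{\mathbf c,\boldsymbol\mu}(\mathcal V)$ for every subflag $\mathcal W\leq\mathcal V$ with $\mathcal W\neq\mathcal V$. Thresholds. $\gamma_k$ (respectively $\widetilde\gamma_k$) is the supremum of the endpoints $c_{r+1}$ over all systems (with any number $r$ of steps) satisfying the weak (respectively strict) entropy condition. *)

theory Defs
  imports "HOL-Probability.Probability"
begin

text \<open>
  The dimension \<open>k\<close> is the cardinality of the index type \<open>'k\<close>, so that the ambient space is
  \<^typ>\<open>rat ^ 'k\<close>. Flags and the tuples \<open>c\<close>, \<open>\<mu>\<close> are functions on the natural numbers together with the
  number \<open>r\<close> of steps; only the values \<open>V 0, \<dots>, V r\<close>, \<open>c 1, \<dots>, c (r + 1)\<close> and
  \<open>\<mu> 1, \<dots>, \<mu> r\<close> are ever used.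
\<close>

definition cube :: "(rat ^ 'k::finite) set" where
  "cube = {v. \<forall>i. v $ i = 0 \<or> v $ i = 1}"

definition flag :: "nat \<Rightarrow> (nat \<Rightarrow> (rat ^ 'k::finite) set) \<Rightarrow> bool" where
  "flag r V \<longleftrightarrow> V 0 = vec.span {\<chi> i. 1} \<and> (\<forall>j\<le>r. vec.subspace (V j)) \<and> (\<forall>j<r. V j \<subseteq> V (Suc j))"

definition complete_flag :: "nat \<Rightarrow> (nat \<Rightarrow> (rat ^ 'k::finite) set) \<Rightarrow> bool" where
  "complete_flag r V \<longleftrightarrow> flag r V \<and> (\<forall>j\<in>{1..r}. vec.dim (V j) = vec.dim (V (j - 1)) + 1)"

text \<open>\<open>refinement r V r' V'\<close>: \<open>V'\<close> is a refinement of \<open>V\<close>; the map \<open>f\<close> gives the positions of the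
  members of \<open>V\<close> in \<open>V'\<close>.\<close>

definition refinement ::
  "nat \<Rightarrow> (nat \<Rightarrow> (rat ^ 'k::finite) set) \<Rightarrow> nat \<Rightarrow> (nat \<Rightarrow> (rat ^ 'k) set) \<Rightarrow> bool" where
  "refinement r V r' V' \<longleftrightarrow> flag r V \<and> flag r' V' \<and>
     (\<exists>f. strict_mono_on {0..r} f \<and> f 0 = 0 \<and> f r = r' \<and> (\<forall>j\<le>r. V' (f j) = V j))"

definition nondegenerate :: "nat \<Rightarrow> (nat \<Rightarrow> (rat ^ 'k::finite) set) \<Rightarrow> bool" where
  "nondegenerate r V \<longleftrightarrow> (\<forall>s t. s \<noteq> t \<longrightarrow> \<not> V r \<subseteq> {v. v $ s = v $ t})"

definition is_system ::
  "nat \<Rightarrow> (nat \<Rightarrow> (rat ^ 'k::finite) set) \<Rightarrow> (nat \<Rightarrow> real) \<Rightarrow> (nat \<Rightarrow> (rat ^ 'k) pmf) \<Rightarrow> bool" where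
  "is_system r V c \<mu> \<longleftrightarrow>
     flag r V \<and> inj_on V {0..r} \<and> (\<forall>j\<le>r. \<exists>S\<subseteq>cube. V j = vec.span S) \<and>
     nondegenerate r V \<and>
     c 1 \<le> 1 \<and> (\<forall>j\<in>{1..r}. c (j + 1) \<le> c j) \<and> 0 \<le> c (r + 1) \<and>
     (\<forall>j\<in>{1..r}. set_pmf (\<mu> j) \<subseteq> V j \<inter> cube)"

definition subflag ::
  "nat \<Rightarrow> (nat \<Rightarrow> (rat ^ 'k::finite) set) \<Rightarrow> (nat \<Rightarrow> (rat ^ 'k) set) \<Rightarrow> bool" where
  "subflag r W V \<longleftrightarrow> flag r W \<and> (\<forall>j\<le>r. W j \<subseteq> V j)"

definition cosets :: "(rat ^ 'k::finite) set \<Rightarrow> (rat ^ 'k) set set" where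
  "cosets W = UNIV // {(x, y). y - x \<in> W}"

definition coset_mass :: "(rat ^ 'k::finite) pmf \<Rightarrow> (rat ^ 'k) set \<Rightarrow> real" where
  "coset_mass \<mu> C = (\<Sum>\<omega>\<in>C \<inter> cube. pmf \<mu> \<omega>)"

text \<open>There are in general infinitely many cosets, so a plain finite sum would be the default value
  zero; only the finitely many cosets meeting the cube contribute to the infinite sum. The convention
  \<open>0 log 0 = 0\<close> holds automatically.\<close>

definition coset_entropy :: "(rat ^ 'k::finite) pmf \<Rightarrow> (rat ^ 'k) set \<Rightarrow> real" where
  "coset_entropy \<mu> W = - (\<Sum>\<^sub>\<infinity>C\<in>cosets W. coset_mass \<mu> C * ln (coset_mass \<mu> C))"

text \<open>For \<open>W (j - 1) \<subseteq> W j\<close> the difference of dimensions below is the dimension of the quotient.\<close>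

definition energy ::
  "nat \<Rightarrow> (nat \<Rightarrow> real) \<Rightarrow> (nat \<Rightarrow> (rat ^ 'k::finite) pmf) \<Rightarrow> (nat \<Rightarrow> (rat ^ 'k) set) \<Rightarrow> real" where
  "energy r c \<mu> W =
     (\<Sum>j=1..r. (c j - c (j + 1)) * coset_entropy (\<mu> j) (W j)) +
     (\<Sum>j=1..r. c j * (real (vec.dim (W j)) - real (vec.dim (W (j - 1)))))"

definition weak_entropy ::
  "nat \<Rightarrow> (nat \<Rightarrow> (rat ^ 'k::finite) set) \<Rightarrow> (nat \<Rightarrow> real) \<Rightarrow> (nat \<Rightarrow> (rat ^ 'k) pmf) \<Rightarrow> bool" where
  "weak_entropy r V c \<mu> \<longleftrightarrow> (\<forall>W. subflag r W V \<longrightarrow> energy r c \<mu> W \<ge> energy r c \<mu> V)"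

definition strict_entropy ::
  "nat \<Rightarrow> (nat \<Rightarrow> (rat ^ 'k::finite) set) \<Rightarrow> (nat \<Rightarrow> real) \<Rightarrow> (nat \<Rightarrow> (rat ^ 'k) pmf) \<Rightarrow> bool" where
  "strict_entropy r V c \<mu> \<longleftrightarrow>
     (\<forall>W. subflag r W V \<and> (\<exists>j\<le>r. W j \<noteq> V j) \<longrightarrow> energy r c \<mu> W > energy r c \<mu> V)"

text \<open>All endpoints lie in \<open>[0,1]\<close>, so the suprema are taken over bounded sets. If \<open>CARD('k) \<ge> 2\<close>, a system
  with \<open>c = 0\<close> satisfies the weak condition, so the first set is nonempty; the second one is nonempty
  as soon as every weak system can be approximated by strict ones.\<close>

definition weak_threshold :: "'k::finite itself \<Rightarrow> real" where
  "weak_threshold _ = Sup {c (r + 1) | r c (V :: nat \<Rightarrow> (rat ^ 'k) set) \<mu>.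
     is_system r V c \<mu> \<and> weak_entropy r V c \<mu>}"

definition strict_threshold :: "'k::finite itself \<Rightarrow> real" where
  "strict_threshold _ = Sup {c (r + 1) | r c (V :: nat \<Rightarrow> (rat ^ 'k) set) \<mu>.
     is_system r V c \<mu> \<and> strict_entropy r V c \<mu>}"

end

theory Submission imports Defs begin

text \<open>
  Everything rests on one observation: on a fixed flag, systems form a convex set, and mixing a weak
  system with a strict one yields a strict one. The energy depends on \<open>(c, \<mu>)\<close> only through \<open>c\<close> and
  the measures \<open>(c j - c (j + 1)) \<mu> j\<close>. If both are replaced by convex combinations, the dimension
  term is affine and, as entropy is concave in the measure, the entropy term can only grow beyond
  the corresponding combination. At \<open>W = V\<close> all entropies vanish, so the energy of \<open>V\<close> itself is exactly
  affine. Hence energy gaps between \<open>W\<close> and \<open>V\<close> are superadditive under mixing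
  (\<open>mix_weak_strict\<close>), and the endpoint of the mixture is the same combination of the two endpoints.

  Two ingredients remain. A weak system on \<open>V\<close> gives a weak system with the same endpoint on any
  refinement spanned by cube points (\<open>weak_system_refine\<close>): keep \<open>c\<close> constant between consecutive
  members of \<open>V\<close>. Summation by parts turns the energy into
  \[ \sum_j (c_j - c_{j+1}) (H_{\mu_j}(W_j) + \dim W_j) + c_{r+1} \dim W_r - c_1 \dim W_0, \]
  in which the inserted spaces then have weight zero, so that nothing changes.

  Secondly, every complete nondegenerate flag spanned by cube points supports some strict system
  (\<open>complete_cube_flag_supports_strict_system\<close>). Let \<open>\<mu> j\<close> be uniform on the three points \<open>0\<close>, \<open>\<omega>\<close>,
  \<open>1 - \<omega>\<close> with \<open>\<omega> \<in> V j\<close> outside \<open>V (j - 1)\<close>, and let \<open>c j = q ^ j\<close> decrease rapidly. At the first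
  \<open>j\<close> with \<open>W j \<noteq> V j\<close> completeness forces \<open>W j = V (j - 1)\<close>; one dimension is lost, but the three
  points lie in distinct cosets and the entropy gained is \<open>ln 3 > 1\<close>. All later terms are negligible.

  Since a complete refinement by cube-spanned spaces always exists
  (\<open>exists_complete_cube_refinement\<close>), mixing the refined weak system with a small
  multiple of the strict one proves the approximation statement, from which the equality of the
  thresholds follows.
\<close>

section \<open>Cosets and entropy\<close>

abbreviation ones :: "rat ^ 'k::finite" where
  "ones \<equiv> (\<chi> i. 1)"

definition coset :: "(rat ^ 'k::finite) set \<Rightarrow> rat ^ 'k \<Rightarrow> (rat ^ 'k) set" where
  "coset W x = {y. y - x \<in> W}"

lemma cosets_eq: "cosets W = range (coset W)"
  by (auto simp: cosets_def coset_def quotient_def)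

lemma coset_eq_iff:
  assumes "vec.subspace W"
  shows "coset W x = coset W y \<longleftrightarrow> x - y \<in> W"
proof
  assume "coset W x = coset W y"
  moreover have "x \<in> coset W x" using vec.subspace_0[OF assms] by (simp add: coset_def)
  ultimately show "x - y \<in> W" by (simp add: coset_def)
next
  assume xy: "x - y \<in> W"
  have "z - x \<in> W \<longleftrightarrow> z - y \<in> W" for z
    using vec.subspace_add[OF assms _ xy, of "z - x"] vec.subspace_diff[OF assms _ xy, of "z - y"]
    by auto
  then show "coset W x = coset W y" by (simp add: coset_def)
qed

lemma finite_cube: "finite (cube :: (rat ^ 'k::finite) set)"
proof -
  have "cube \<subseteq> vec_lambda ` (UNIV \<rightarrow>\<^sub>E {0, 1 :: rat} :: ('k \<Rightarrow> rat) set)"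
  proof
    fix v :: "rat ^ 'k" assume "v \<in> cube"
    then have "($) v \<in> UNIV \<rightarrow>\<^sub>E {0, 1}" by (auto simp: cube_def)
    then show "v \<in> vec_lambda ` (UNIV \<rightarrow>\<^sub>E {0, 1})" by (metis image_eqI vec_nth_inverse)
  qed
  then show ?thesis by (rule finite_subset) (intro finite_imageI finite_PiE; simp)
qed

lemma cube_facts:
  "(0 :: rat ^ 'k::finite) \<in> cube" "ones \<in> (cube :: (rat ^ 'k) set)"
  "v \<in> cube \<Longrightarrow> ones - v \<in> (cube :: (rat ^ 'k) set)"
  by (auto simp: cube_def)

lemma coset_mass_nonneg: "0 \<le> coset_mass \<mu> C"
  by (simp add: coset_mass_def sum_nonneg)

lemma coset_mass_eq_measure: "coset_mass \<mu> C = measure_pmf.prob \<mu> (C \<inter> cube)"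
  unfolding coset_mass_def using finite_cube by (intro measure_measure_pmf_finite[symmetric]) auto

lemma coset_mass_le_1: "coset_mass \<mu> C \<le> 1"
  by (simp add: coset_mass_eq_measure)

text \<open>Cosets that miss the cube carry no mass, so the infinite sum is a finite one. In this form it can
  be manipulated without summability side conditions.\<close>

lemma coset_entropy_finite:
  "coset_entropy \<mu> W = (\<Sum>C\<in>coset W ` cube. - (coset_mass \<mu> C * ln (coset_mass \<mu> C)))"
    if "vec.subspace W"
proof -
  have "coset_mass \<mu> C = 0" if "C \<in> cosets W - coset W ` cube" for C
  proof -
    from that obtain x where C: "C = coset W x" by (auto simp: cosets_eq)
    have "C \<inter> cube = {}"
    proof (rule ccontr)
      assume "C \<inter> cube \<noteq> {}"
      then obtain y where "y \<in> C" "y \<in> cube" by auto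
      then have "coset W y = C"
        unfolding C coset_eq_iff[OF \<open>vec.subspace W\<close>] by (simp add: coset_def)
      with \<open>y \<in> cube\<close> that show False by auto
    qed
    then show ?thesis by (simp add: coset_mass_def)
  qed
  then have "(\<Sum>\<^sub>\<infinity>C\<in>cosets W. coset_mass \<mu> C * ln (coset_mass \<mu> C)) =
    (\<Sum>\<^sub>\<infinity>C\<in>coset W ` cube. coset_mass \<mu> C * ln (coset_mass \<mu> C))"
    by (intro infsum_cong_neutral) (auto simp: cosets_eq)
  then show ?thesis by (simp add: coset_entropy_def sum_negf finite_cube)
qed

lemma entropy_term_nonneg: "0 \<le> - (coset_mass \<mu> C * ln (coset_mass \<mu> C))"
proof (cases "coset_mass \<mu> C = 0")
  case False
  with coset_mass_nonneg[of \<mu> C] have "ln (coset_mass \<mu> C) \<le> 0"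
    using coset_mass_le_1[of \<mu> C] by (subst ln_le_zero_iff) linarith+
  then show ?thesis using coset_mass_nonneg[of \<mu> C] by (simp add: mult_nonneg_nonpos)
qed simp

lemma coset_entropy_nonneg: "vec.subspace W \<Longrightarrow> 0 \<le> coset_entropy \<mu> W"
  by (simp only: coset_entropy_finite) (intro sum_nonneg entropy_term_nonneg)

text \<open>A measure supported in \<open>W\<close> sees the single coset \<open>W\<close>. Applied to \<open>W = V j\<close> this removes every
  entropy from the energy of the full flag.\<close>

lemma coset_entropy_eq_0:
  assumes "vec.subspace W" "set_pmf \<mu> \<subseteq> W \<inter> cube"
  shows "coset_entropy \<mu> W = 0"
proof -
  have "coset_mass \<mu> C = 0 \<or> coset_mass \<mu> C = 1" if "C \<in> cosets W" for C
  proof -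
    from that obtain x where C: "C = coset W x" by (auto simp: cosets_eq)
    show ?thesis
    proof (cases "x \<in> W")
      case True
      then have "C = coset W 0" unfolding C coset_eq_iff[OF assms(1)] by simp
      then have "set_pmf \<mu> \<subseteq> C \<inter> cube" using assms by (auto simp: coset_def)
      then have "coset_mass \<mu> C = 1"
        unfolding coset_mass_eq_measure by (subst measure_pmf.prob_eq_1) (auto simp: AE_measure_pmf_iff)
      then show ?thesis by simp
    next
      case False
      have "y \<notin> W" if "y \<in> C" for y
        using that False vec.subspace_diff[OF assms(1), of y "y - x"] by (auto simp: C coset_def)
      then have "pmf \<mu> y = 0" if "y \<in> C" for y
        using assms(2) that by (auto simp: pmf_eq_0_set_pmf)
      then show ?thesis by (auto simp: coset_mass_def)
    qed
  qed
  then have "coset_mass \<mu> C * ln (coset_mass \<mu> C) = 0" if "C \<in> cosets W" for C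
    using that by fastforce
  then show ?thesis unfolding coset_entropy_def by (simp add: infsum_0)
qed

lemma x_ln_x_ge_tangent:
  fixes x y :: real
  assumes "0 \<le> x" "0 < y"
  shows "x * ln x \<ge> x * ln y + x - y"
proof (cases "x = 0")
  case False
  with assms have x: "0 < x" by simp
  have "ln (y / x) \<le> y / x - 1" using x assms by (intro ln_le_minus_one) simp
  then have "x * ln (y / x) \<le> x * (y / x - 1)" using x by (intro mult_left_mono) auto
  then show ?thesis using x assms by (simp add: ln_div algebra_simps)
qed (use assms in auto)

text \<open>Convexity on the closed half-line, zero included, since cosets of mass zero do occur. The
  tangent of \<open>x ln x\<close> at the mixed point lies below the graph at both \<open>a\<close> and \<open>b\<close>.\<close>

lemma x_ln_x_convex:
  fixes a b s :: real
  assumes "0 \<le> a" "0 \<le> b" "0 \<le> s" "s \<le> 1"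
  defines "m \<equiv> (1 - s) * a + s * b"
  shows "m * ln m \<le> (1 - s) * (a * ln a) + s * (b * ln b)"
proof -
  have "(1 - s) * a \<ge> 0" "s * b \<ge> 0" using assms by auto
  then have "m > 0 \<or> (1 - s) * a = 0 \<and> s * b = 0" unfolding m_def by linarith
  then show ?thesis
  proof
    assume m: "m > 0"
    have "(1 - s) * (a * ln a) + s * (b * ln b)
      \<ge> (1 - s) * (a * ln m + a - m) + s * (b * ln m + b - m)"
      using assms x_ln_x_ge_tangent[OF _ m] by (intro add_mono mult_left_mono) auto
    also have "(1 - s) * (a * ln m + a - m) + s * (b * ln m + b - m)
        = ((1 - s) * a + s * b) * ln m + ((1 - s) * a + s * b) - m"
      by (simp add: algebra_simps)
    finally show ?thesis by (simp flip: m_def)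
  next
    assume "(1 - s) * a = 0 \<and> s * b = 0"
    then show ?thesis unfolding m_def by auto
  qed
qed

definition mix_pmf :: "real \<Rightarrow> 'a pmf \<Rightarrow> 'a pmf \<Rightarrow> 'a pmf" where
  "mix_pmf s \<mu> \<nu> = bernoulli_pmf s \<bind> (\<lambda>b. if b then \<nu> else \<mu>)"

lemma set_mix_pmf: "set_pmf (mix_pmf s \<mu> \<nu>) \<subseteq> set_pmf \<mu> \<union> set_pmf \<nu>"
  by (auto simp: mix_pmf_def split: if_splits)

lemma pmf_mix_pmf:
  assumes "0 \<le> s" "s \<le> 1"
  shows "pmf (mix_pmf s \<mu> \<nu>) x = (1 - s) * pmf \<mu> x + s * pmf \<nu> x"
  using assms by (simp add: mix_pmf_def pmf_bind)

lemma coset_entropy_concave: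
  assumes "vec.subspace W" "0 \<le> s" "s \<le> 1"
  shows "coset_entropy (mix_pmf s \<mu> \<nu>) W \<ge> (1 - s) * coset_entropy \<mu> W + s * coset_entropy \<nu> W"
proof -
  have mass: "coset_mass (mix_pmf s \<mu> \<nu>) C = (1 - s) * coset_mass \<mu> C + s * coset_mass \<nu> C" for C
    using assms by (simp add: coset_mass_def pmf_mix_pmf sum.distrib sum_distrib_left)
  show ?thesis
    unfolding coset_entropy_finite[OF assms(1)] sum_distrib_left sum.distrib[symmetric]
  proof (rule sum_mono)
    fix C
    show "(1 - s) * - (coset_mass \<mu> C * ln (coset_mass \<mu> C)) +
         s * - (coset_mass \<nu> C * ln (coset_mass \<nu> C))
         \<le> - (coset_mass (mix_pmf s \<mu> \<nu>) C * ln (coset_mass (mix_pmf s \<mu> \<nu>) C))"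
      using x_ln_x_convex[OF coset_mass_nonneg[of \<mu> C] coset_mass_nonneg[of \<nu> C] assms(2,3)]
      unfolding mass by simp
  qed
qed

text \<open>Modulo \<open>W\<close> the three points are \<open>0\<close>, \<open>\<omega>\<close> and \<open>- \<omega>\<close>, which are pairwise distinct because
  neither \<open>\<omega>\<close> nor \<open>2 \<omega>\<close> lies in \<open>W\<close>. Two points would give only \<open>ln 2 < 1\<close>, which does not
  compensate the loss of a dimension; it is the reflection \<open>\<omega> \<mapsto> 1 - \<omega>\<close> of the cube that
  provides the third one.\<close>

lemma coset_entropy_ge_ln_3:
  assumes W: "vec.subspace W" "ones \<in> W" and \<omega>: "\<omega> \<in> cube" "\<omega> \<notin> W"
  shows "coset_entropy (pmf_of_set {0, \<omega>, ones - \<omega>}) W \<ge> ln 3"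
proof -
  let ?A = "{0, \<omega>, ones - \<omega>}"
  let ?\<mu> = "pmf_of_set ?A"
  have A: "?A \<subseteq> cube" using \<omega> cube_facts by blast
  have 1: "ones - \<omega> \<notin> W" using vec.subspace_diff[OF W(1) W(2), of "ones - \<omega>"] \<omega> by auto
  have 2: "\<omega> - (ones - \<omega>) \<notin> W"
  proof
    assume "\<omega> - (ones - \<omega>) \<in> W"
    then have "\<omega> - (ones - \<omega>) + ones \<in> W" using W by (intro vec.subspace_add)
    also have "\<omega> - (ones - \<omega>) + ones = 2 *s \<omega>" by (simp add: vec_eq_iff)
    finally have "(1 / 2) *s (2 *s \<omega>) \<in> W" by (rule vec.subspace_scale[OF W(1)])
    also have "(1 / 2) *s (2 *s \<omega>) = \<omega>" by (simp add: vec_eq_iff)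
    finally show False using \<omega> by simp
  qed
  have inj: "inj_on (coset W) ?A"
  proof -
    have swap: "y - x \<notin> W" if "x - y \<notin> W" for x y
      using vec.subspace_neg[OF W(1), of "y - x"] that by auto
    have 3: "\<omega> - 0 \<notin> W" "(ones - \<omega>) - 0 \<notin> W" using 1 \<omega>(2) by auto
    show ?thesis
      using 2 3 3[THEN swap] swap[OF 2] unfolding inj_on_def coset_eq_iff[OF W(1)] by blast
  qed
  have card: "card ?A = 3"
  proof -
    have "0 \<noteq> \<omega>" "0 \<noteq> ones - \<omega>" "\<omega> \<noteq> ones - \<omega>"
      using \<omega> 1 2 vec.subspace_0[OF W(1)] by auto
    then show ?thesis by simp
  qed
  have mass: "coset_mass ?\<mu> (coset W x) = 1 / 3" if "x \<in> ?A" for x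
  proof -
    have "y = x" if "y \<in> coset W x" "y \<in> ?A" for y
    proof -
      have "coset W y = coset W x" using that(1) unfolding coset_eq_iff[OF W(1)] by (simp add: coset_def)
      then show ?thesis by (rule inj_onD[OF inj _ that(2) \<open>x \<in> ?A\<close>])
    qed
    moreover have "x \<in> coset W x" using vec.subspace_0[OF W(1)] by (simp add: coset_def)
    ultimately have "?A \<inter> (coset W x \<inter> cube) = {x}"
      using that subsetD[OF A] by (intro equalityI subsetI) blast+
    then show ?thesis unfolding coset_mass_eq_measure
      by (subst measure_pmf_of_set) (simp_all only: card, simp_all)
  qed
  have "ln 3 = (\<Sum>x\<in>?A. - (1 / 3 * ln (1 / 3 :: real)))"
    by (simp add: card ln_div del: sum.insert card_insert_disjoint)
  also have "\<dots> = (\<Sum>x\<in>?A. - (coset_mass ?\<mu> (coset W x) * ln (coset_mass ?\<mu> (coset W x))))"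
    by (intro sum.cong refl) (simp only: mass)
  also have "\<dots> = (\<Sum>C\<in>coset W ` ?A. - (coset_mass ?\<mu> C * ln (coset_mass ?\<mu> C)))"
    by (simp only: sum.reindex[OF inj] o_def)
  also have "\<dots> \<le> coset_entropy ?\<mu> W"
    unfolding coset_entropy_finite[OF W(1)] using A
    by (intro sum_mono2 entropy_term_nonneg finite_imageI finite_cube image_mono)
  finally show ?thesis .
qed

section \<open>Complete flags support strict systems\<close>

lemma flag_mono:
  assumes "flag r V" "i \<le> j" "j \<le> r"
  shows "V i \<subseteq> V j"
  using assms(2,3)
proof (induction j rule: dec_induct)
  case (step n)
  have "V n \<subseteq> V (Suc n)" using step.prems assms(1) by (simp add: flag_def Suc_le_eq)
  then show ?case using step by simp
qed simp

lemma ones_in_flag: "flag r V \<Longrightarrow> j \<le> r \<Longrightarrow> ones \<in> V j"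
  using flag_mono[of r V 0 j] by (auto simp: flag_def intro: vec.span_base)

lemma flag_subspace: "flag r V \<Longrightarrow> j \<le> r \<Longrightarrow> vec.subspace (V j)"
  by (simp add: flag_def)

lemma complete_flag_dim:
  assumes "complete_flag r V" "j \<le> r"
  shows "vec.dim (V j) = vec.dim (V 0) + j"
  using assms(2)
proof (induction j)
  case (Suc j)
  then show ?case using assms(1) by (auto simp: complete_flag_def)
qed simp

lemma complete_flag_inj_on: "complete_flag r V \<Longrightarrow> inj_on V {0..r}"
  by (rule inj_onI) (metis add_left_cancel atLeastAtMost_iff complete_flag_dim)

definition cube_spanned :: "(rat ^ 'k::finite) set \<Rightarrow> bool" where
  "cube_spanned U \<longleftrightarrow> (\<exists>S\<subseteq>cube. U = vec.span S)"

lemma cube_spanned_exists_outside: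
  assumes "cube_spanned U" "vec.subspace W" "\<not> U \<subseteq> W"
  obtains \<omega> where "\<omega> \<in> cube" "\<omega> \<in> U" "\<omega> \<notin> W"
proof -
  from assms(1) obtain S where S: "S \<subseteq> cube" "U = vec.span S" by (auto simp: cube_spanned_def)
  have "\<not> S \<subseteq> W" using vec.span_minimal[of S W] assms(2,3) S(2) by blast
  then show ?thesis using that S vec.span_base by blast
qed

text \<open>With \<open>c j = q ^ j\<close>, a subflag that first deviates at step \<open>j\<close> gains at least
  \<open>(q ^ j - q ^ (j + 1)) ln 3\<close> of entropy there and loses at most \<open>q ^ i\<close> of dimension at each
  \<open>i \<ge> j\<close>, in total less than \<open>q ^ j / (1 - q)\<close>. The balance is positive as soon as
  \<open>(1 - q)\<^sup>2 ln 3 > 1\<close>, a condition that does not depend on the flag.\<close>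

lemma complete_cube_flag_supports_strict_system:
  fixes V :: "nat \<Rightarrow> (rat ^ 'k::finite) set"
  assumes "complete_flag r V" "\<And>j. j \<le> r \<Longrightarrow> cube_spanned (V j)" "nondegenerate r V"
  obtains c \<mu> where "is_system r V c \<mu>" "strict_entropy r V c \<mu>"
proof -
  have flag: "flag r V" using assms(1) by (simp add: complete_flag_def)
  have sub: "vec.subspace (V j)" if "j \<le> r" for j using flag that by (rule flag_subspace)
  have dim_step: "vec.dim (V j) = vec.dim (V (j - 1)) + 1" if "j \<in> {1..r}" for j
    using assms(1) that by (simp add: complete_flag_def)
  have "\<exists>\<omega>. \<omega> \<in> cube \<and> \<omega> \<in> V j \<and> \<omega> \<notin> V (j - 1)" if "j \<in> {1..r}" for j
  proof -
    have "\<not> V j \<subseteq> V (j - 1)" using dim_step[OF that] vec.dim_subset[of "V j" "V (j - 1)"] by auto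
    moreover have "cube_spanned (V j)" "vec.subspace (V (j - 1))"
      using that by (auto intro: assms(2) sub)
    ultimately show ?thesis using cube_spanned_exists_outside by blast
  qed
  then obtain \<omega> where \<omega>: "\<omega> j \<in> cube" "\<omega> j \<in> V j" "\<omega> j \<notin> V (j - 1)" if "j \<in> {1..r}" for j
    by metis
  define \<mu> where "\<mu> j = pmf_of_set {0, \<omega> j, ones - \<omega> j}" for j
  have supp: "set_pmf (\<mu> j) \<subseteq> V j \<inter> cube" if "j \<in> {1..r}" for j
  proof -
    have "ones - \<omega> j \<in> V j" using that \<omega> flag
      by (intro vec.subspace_diff sub ones_in_flag) auto
    moreover have "0 \<in> V j" using that by (intro vec.subspace_0 sub) auto
    ultimately show ?thesis
      using \<omega>[OF that] cube_facts by (auto simp: \<mu>_def)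
  qed
  obtain s :: real where s: "sqrt (1 / ln 3) < s" "s < 1"
    using dense[of "sqrt (1 / ln 3)" 1] ln3_gt_1 by auto
  define q where "q = 1 - s"
  have "0 \<le> sqrt (1 / ln (3 :: real))" by simp
  then have q: "0 < q" "q < 1" using s unfolding q_def by linarith+
  have "1 / ln 3 < s\<^sup>2" 
    using power_strict_mono[OF s(1), of 2] ln3_gt_1 by simp
  then have q_small: "1 < (1 - q)\<^sup>2 * ln 3" using ln3_gt_1 by (simp add: q_def field_simps)
  define c where "c j = q ^ j" for j :: nat
  have "is_system r V c \<mu>"
    unfolding is_system_def
    using flag complete_flag_inj_on[OF assms(1)] assms(2,3) supp q
    by (auto simp: cube_spanned_def c_def mult_le_cancel_right1)
  moreover have "strict_entropy r V c \<mu>"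
    unfolding strict_entropy_def
  proof (intro allI impI)
    fix W assume W: "subflag r W V \<and> (\<exists>j\<le>r. W j \<noteq> V j)"
    then have flagW: "flag r W" and WV: "\<And>j. j \<le> r \<Longrightarrow> W j \<subseteq> V j" by (auto simp: subflag_def)
    define j where "j = (LEAST j. j \<le> r \<and> W j \<noteq> V j)"
    from W have j: "j \<le> r" "W j \<noteq> V j"
      using LeastI_ex[of "\<lambda>j. j \<le> r \<and> W j \<noteq> V j"] by (auto simp: j_def)
    have before: "W i = V i" if "i < j" for i
      using not_less_Least[OF that[unfolded j_def]] that j(1) by auto
    have "j \<noteq> 0" using j(2) flag flagW by (metis flag_def)
    then have j_in: "j \<in> {1..r}" using j(1) by auto
    have "V (j - 1) \<subseteq> W j"
      using before[of "j - 1"] \<open>j \<noteq> 0\<close> flag_mono[OF flagW, of "j - 1" j] j(1) by auto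
    moreover have "vec.dim (W j) < vec.dim (V j)"
      using vec.subspace_dim_equal[of "W j" "V j"] j sub flag_subspace[OF flagW] WV
      by (meson not_le)
    ultimately have Wj: "W j = V (j - 1)"
      using vec.subspace_dim_equal[of "V (j - 1)" "W j"] sub flag_subspace[OF flagW] j(1) dim_step[OF j_in]
      by (metis Suc_eq_plus1 diff_le_self le_trans less_Suc_eq_le)
    have ent: "coset_entropy (\<mu> j) (W j) \<ge> ln 3"
      unfolding \<mu>_def using \<omega>[OF j_in] flag_subspace[OF flagW j(1)] ones_in_flag[OF flagW j(1)]
      by (intro coset_entropy_ge_ln_3) (simp_all add: Wj)
    let ?d = "\<lambda>X i. real (vec.dim (X i :: (rat ^ 'k) set)) - real (vec.dim (X (i - 1)))"
    let ?low = "\<lambda>i. (if i = j then (1 - q) * q ^ j * ln 3 else 0) - (if j \<le> i then q ^ i else 0)"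
    (* In the energy of V every dimension increment is 1 and every entropy 0, so the sum of the
       right-hand sides is the energy gap; dimension increments of W beyond j are merely bounded
       below by 0. *)
    have low: "?low i \<le> (c i - c (i + 1)) * coset_entropy (\<mu> i) (W i) + c i * (?d W i - 1)"
      if i: "i \<in> {1..r}" for i
    proof -
      have \<delta>: "c i - c (i + 1) = (1 - q) * q ^ i" by (simp add: c_def algebra_simps)
      then have \<delta>0: "0 \<le> c i - c (i + 1)" using q by simp
      have H: "0 \<le> coset_entropy (\<mu> i) (W i)"
        using i by (intro coset_entropy_nonneg flag_subspace[OF flagW]) auto
      consider "i < j" | "i = j" | "j < i" by linarith
      then show ?thesis
      proof cases
        case 1
        then have "?d W i = 1" using dim_step[OF i] before[of i] before[of "i - 1"] by simp
        with 1 \<delta>0 H show ?thesis by simp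
      next
        case 2
        have "?d W i = 0" using 2 Wj before[of "j - 1"] \<open>j \<noteq> 0\<close> by simp
        moreover have "(c i - c (i + 1)) * ln 3 \<le> (c i - c (i + 1)) * coset_entropy (\<mu> i) (W i)"
          using ent \<delta>0 2 by (intro mult_left_mono) auto
        ultimately show ?thesis using 2 unfolding \<delta> by (simp add: c_def)
      next
        case 3
        have "0 \<le> ?d W i"
          using vec.dim_subset[OF flag_mono[OF flagW, of "i - 1" i]] i by auto
        then have "c i * (0 - 1) \<le> c i * (?d W i - 1)"
          using q by (intro mult_left_mono) (auto simp: c_def)
        moreover have "0 \<le> (c i - c (i + 1)) * coset_entropy (\<mu> i) (W i)" using \<delta>0 H by simp
        ultimately show ?thesis using 3 by (simp add: c_def)
      qed
    qed
    have "0 < q ^ j * ((1 - q)\<^sup>2 * ln 3 - 1) + q ^ (r + 1)"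
      using q q_small by (intro add_pos_pos mult_pos_pos) auto
    also have "\<dots> = (1 - q) * ((1 - q) * q ^ j * ln 3 - (\<Sum>i=j..r. q ^ i))"
      using sum_gp_multiplied[OF j(1), of q] by (simp add: algebra_simps power2_eq_square)
    finally have "0 < (1 - q) * q ^ j * ln 3 - (\<Sum>i=j..r. q ^ i)"
      using q by (simp add: zero_less_mult_iff)
    also have "(\<Sum>i=j..r. q ^ i) = (\<Sum>i=1..r. if j \<le> i then q ^ i else 0)"
      using j_in by (intro sum.mono_neutral_cong_left) auto
    also have "(1 - q) * q ^ j * ln 3 - \<dots> = (\<Sum>i=1..r. ?low i)"
      using j_in by (subst sum_subtractf) (simp add: sum.delta')
    also have "\<dots> \<le> (\<Sum>i=1..r. (c i - c (i + 1)) * coset_entropy (\<mu> i) (W i) + c i * (?d W i - 1))"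
      by (intro sum_mono low)
    also have "\<dots> = energy r c \<mu> W - energy r c \<mu> V"
    proof -
      have "energy r c \<mu> V = (\<Sum>i=1..r. c i)"
        using dim_step supp by (simp add: energy_def coset_entropy_eq_0[OF sub])
      then show ?thesis by (simp add: energy_def sum.distrib sum_subtractf right_diff_distrib)
    qed
    finally show "energy r c \<mu> V < energy r c \<mu> W" by simp
  qed
  ultimately show ?thesis by (rule that)
qed

section \<open>Complete refinements\<close>

lemma cube_spanned_subspace: "cube_spanned U \<Longrightarrow> vec.subspace U"
  by (auto simp: cube_spanned_def)

lemma cube_spanned_insert:
  assumes "cube_spanned U" "\<omega> \<in> cube"
  shows "cube_spanned (vec.span (insert \<omega> U))"
proof -
  from assms obtain S where "S \<subseteq> cube" "U = vec.span S" by (auto simp: cube_spanned_def)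
  moreover have "vec.span (insert \<omega> (vec.span S)) = vec.span (insert \<omega> S)"
    by (rule vec.span_eq[THEN iffD2]) (auto simp: vec.span_base
      intro: vec.span_mono[THEN subsetD, rotated] vec.span_base)
  ultimately show ?thesis
    using assms(2) unfolding cube_spanned_def by (intro exI[of _ "insert \<omega> S"]) simp
qed

text \<open>The refinement grows by one cube point at a time. What makes it pass through every \<open>V j\<close> is that
  the new point is taken from the first \<open>V j\<close> not yet covered: then each space built is comparable
  with all members of \<open>V\<close>, and hence equal to \<open>V j\<close> once the dimensions agree.\<close>

lemma exists_complete_cube_refinement:
  fixes V :: "nat \<Rightarrow> (rat ^ 'k::finite) set"
  assumes flag: "flag r V" and inj: "inj_on V {0..r}" and span: "\<And>j. j \<le> r \<Longrightarrow> cube_spanned (V j)"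
  obtains r' V' where "refinement r V r' V'" "complete_flag r' V'" "\<And>i. cube_spanned (V' i)"
proof -
  note sub = flag_subspace[OF flag] and mono = flag_mono[OF flag]
  let ?d = "\<lambda>j. vec.dim (V j)"
  have d0: "?d 0 = 1" using flag by (simp add: flag_def vec_eq_iff)
  (* Once V r is reached the chain stays there; the minimum makes the construction total. *)
  have "\<exists>V'. \<forall>i. (cube_spanned (V' i) \<and> vec.dim (V' i) = min (i + 1) (?d r) \<and>
      (\<forall>j\<le>r. V' i \<subseteq> V j \<or> V j \<subseteq> V' i)) \<and> V' i \<subseteq> V' (Suc i)"
  proof (rule dependent_nat_choice)
    show "\<exists>U. cube_spanned U \<and> vec.dim U = min (0 + 1) (?d r) \<and>
      (\<forall>j\<le>r. U \<subseteq> V j \<or> V j \<subseteq> U)"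
      using d0 vec.dim_subset[OF mono[of 0 r]] mono[of 0] span[of 0] by (intro exI[of _ "V 0"]) auto
  next
    fix U i
    assume U: "cube_spanned U \<and> vec.dim U = min (i + 1) (?d r) \<and> (\<forall>j\<le>r. U \<subseteq> V j \<or> V j \<subseteq> U)"
    then have subU: "vec.subspace U" by (simp add: cube_spanned_subspace)
    show "\<exists>U'. (cube_spanned U' \<and> vec.dim U' = min (Suc i + 1) (?d r) \<and>
      (\<forall>j\<le>r. U' \<subseteq> V j \<or> V j \<subseteq> U')) \<and> U \<subseteq> U'"
    proof (cases "?d r \<le> i + 1")
      case True
      with U show ?thesis by (intro exI[of _ U]) auto
    next
      case False
      then have dimU: "vec.dim U = i + 1" using U by simp
      define j where "j = (LEAST j. j \<le> r \<and> \<not> V j \<subseteq> U)"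
      have "\<not> V r \<subseteq> U" using vec.dim_subset[of "V r" U] dimU False by auto
      then have j: "j \<le> r" "\<not> V j \<subseteq> U"
        using LeastI[of "\<lambda>j. j \<le> r \<and> \<not> V j \<subseteq> U" r] by (auto simp: j_def)
      have before: "V i \<subseteq> U" if "i < j" for i
        using not_less_Least[OF that[unfolded j_def]] that j(1) by auto
      obtain \<omega> where \<omega>: "\<omega> \<in> cube" "\<omega> \<in> V j" "\<omega> \<notin> U"
        using cube_spanned_exists_outside[OF span[OF j(1)] subU j(2)] .
      let ?U = "vec.span (insert \<omega> U)"
      have UU: "U \<subseteq> ?U" by (auto intro: vec.span_base)
      have "?U \<subseteq> V j" using U j \<omega> sub by (intro vec.span_minimal) auto
      then have "?U \<subseteq> V l \<or> V l \<subseteq> ?U" if "l \<le> r" for l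
        using before[of l] UU mono[of j l] that by (cases "l < j") auto
      moreover have "vec.dim ?U = i + 2"
        using \<omega>(3) dimU subU by (simp add: vec.dim_insert vec.span_eq_iff[THEN iffD2] del: vec.span_eq_iff)
      ultimately show ?thesis
        using U \<omega>(1) False UU by (intro exI[of _ ?U]) (auto simp: cube_spanned_insert)
    qed
  qed
  then obtain V' where V': "\<And>i. cube_spanned (V' i)" "\<And>i. vec.dim (V' i) = min (i + 1) (?d r)"
      "\<And>i j. j \<le> r \<Longrightarrow> V' i \<subseteq> V j \<or> V j \<subseteq> V' i" "\<And>i. V' i \<subseteq> V' (Suc i)"
    by blast
  have pos: "1 \<le> ?d j" "?d j \<le> ?d r" if "j \<le> r" for j
  proof -
    show "1 \<le> ?d j" using d0 vec.dim_subset[OF mono[of 0 j]] that by auto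
    show "?d j \<le> ?d r" using vec.dim_subset[OF mono[of j r]] that by auto
  qed
  have hit: "V' (?d j - 1) = V j" if "j \<le> r" for j
  proof -
    have "vec.dim (V' (?d j - 1)) = ?d j" using V'(2) pos[OF that] by simp
    then show ?thesis
      using V'(3)[OF that] vec.subspace_dim_equal sub[OF that] cube_spanned_subspace[OF V'(1)]
      by (metis order_refl)
  qed
  let ?r = "?d r - 1"
  have "flag ?r V'"
    using hit[of 0] d0 flag V'(4) cube_spanned_subspace[OF V'(1)] by (simp add: flag_def)
  moreover from this have "complete_flag ?r V'"
    using V'(2) by (auto simp: complete_flag_def)
  moreover have "strict_mono_on {0..r} (\<lambda>j. ?d j - 1)"
  proof (rule strict_mono_onI)
    fix a b assume ab: "a \<in> {0..r}" "b \<in> {0..r}" "a < b"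
    then have "V a \<noteq> V b" using inj by (auto dest: inj_onD)
    then have "\<not> ?d b \<le> ?d a"
      using vec.subspace_dim_equal[OF sub sub mono, of a b] ab by auto
    then show "?d a - 1 < ?d b - 1" using pos[of a] pos[of b] ab by auto
  qed
  ultimately have "refinement r V ?r V'"
    unfolding refinement_def using flag hit d0
    by (intro conjI exI[of _ "\<lambda>j. ?d j - 1"]) auto
  then show ?thesis using \<open>complete_flag ?r V'\<close> V'(1) by (rule that)
qed

section \<open>Transfer of weak systems to refinements\<close>

lemma energy_cong: "(\<And>j. j \<le> r \<Longrightarrow> W j = V j) \<Longrightarrow> energy r c \<mu> W = energy r c \<mu> V"
  unfolding energy_def by (intro arg_cong2[where f = "(+)"] sum.cong) auto

lemma energy_by_parts:
  "energy r c \<mu> W =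
     (\<Sum>j=1..r. (c j - c (j + 1)) * (coset_entropy (\<mu> j) (W j) + real (vec.dim (W j)))) +
     c (r + 1) * real (vec.dim (W r)) - c 1 * real (vec.dim (W 0))"
  by (induction r) (simp_all add: energy_def algebra_simps)

lemma refined_subflag:
  assumes f: "strict_mono_on {0..r} f" "f 0 = 0" "f r = r'" "\<And>j. j \<le> r \<Longrightarrow> V' (f j) = V j"
    and W: "subflag r' W V'"
  shows "subflag r (W \<circ> f) V"
proof -
  have flagW: "flag r' W" using W by (simp add: subflag_def)
  have le: "f i \<le> f j" if "i \<le> j" "j \<le> r" for i j
    using strict_mono_onD[OF f(1), of i j] that by (cases "i = j") auto
  have le_r': "f j \<le> r'" if "j \<le> r" for j using le[of j r] that f(3) by simp
  have "W (f j) \<subseteq> V j" "vec.subspace (W (f j))" if "j \<le> r" for j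
    using W f(4)[OF that] le_r'[OF that] flag_subspace[OF flagW] by (auto simp: subflag_def)
  moreover have "W (f j) \<subseteq> W (f (Suc j))" if "j < r" for j
    using flag_mono[OF flagW le le_r'] that by simp
  moreover have "W (f 0) = vec.span {ones}" using flagW f(2) by (simp add: flag_def)
  ultimately show ?thesis by (simp add: subflag_def flag_def)
qed

text \<open>The tuple \<open>c\<close> is stretched so that it drops only at the positions \<open>f j\<close> of the old members. By
  summation by parts, the energy of a subflag \<open>W\<close> of the refinement is then the old energy of
  \<open>W \<circ> f\<close>. The measures at inserted positions have weight zero, and any measure supported at the
  origin will do.\<close>

lemma weak_system_refine:
  fixes V V' :: "nat \<Rightarrow> (rat ^ 'k::finite) set"
  assumes sys: "is_system r V c \<mu>" and weak: "weak_entropy r V c \<mu>"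
    and ref: "refinement r V r' V'" and inj: "inj_on V' {0..r'}"
    and span: "\<And>i. i \<le> r' \<Longrightarrow> cube_spanned (V' i)"
  obtains c' \<mu>' where "is_system r' V' c' \<mu>'" "weak_entropy r' V' c' \<mu>'" "c' (r' + 1) = c (r + 1)"
proof -
  from ref obtain f where f: "strict_mono_on {0..r} f" "f 0 = 0" "f r = r'" "\<And>j. j \<le> r \<Longrightarrow> V' (f j) = V j"
    by (auto simp: refinement_def)
  have flag': "flag r' V'" using ref by (simp add: refinement_def)
  have less: "f i < f j \<longleftrightarrow> i < j" if "i \<le> r" "j \<le> r" for i j
    using strict_mono_on_less[OF f(1)] that by simp
  (* g i is the index of the first old member at or after position i, and r + 1 past the end. *)
  define g where "g i = card {j \<in> {0..r}. f j < i}" for i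
  have g_f: "g (f j) = j" if "j \<le> r" for j
  proof -
    have "{l \<in> {0..r}. f l < f j} = {0..<j}" using less that by auto
    then show ?thesis by (simp add: g_def)
  qed
  have g_Suc_f: "g (Suc (f j)) = Suc j" if "j \<le> r" for j
  proof -
    have "{l \<in> {0..r}. f l < Suc (f j)} = {0..j}" using less[of j] that by (auto simp: less_Suc_eq_le not_less[symmetric])
    then show ?thesis by (simp add: g_def)
  qed
  have g_Suc: "g (Suc i) = g i" if "i \<notin> f ` {0..r}" for i
  proof -
    have "{l \<in> {0..r}. f l < Suc i} = {l \<in> {0..r}. f l < i}" using that by (auto simp: less_Suc_eq)
    then show ?thesis by (simp add: g_def)
  qed
  define c' where "c' i = c (g i)" for i
  define \<mu>' where "\<mu>' i = (if i \<in> f ` {0..r} then \<mu> (g i) else return_pmf 0)" for i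
  have f_range: "f j \<in> {1..r'}" if "j \<in> {1..r}" for j
    using that less[of 0 j] less[of r j] f(2,3) by auto
  have hit: "i \<in> f ` {1..r}" if "i \<in> f ` {0..r}" "i \<in> {1..r'}" for i
  proof -
    from that(1) obtain j where j: "j \<le> r" "i = f j" by auto
    with that(2) f(2) have "j \<noteq> 0" by (metis atLeastAtMost_iff not_one_le_zero)
    with j show ?thesis by auto
  qed
  have c1: "c' 1 = c 1" using g_Suc_f[of 0] f(2) by (simp add: c'_def)
  have cr: "c' (r' + 1) = c (r + 1)" using g_Suc_f[of r] f(3) by (simp add: c'_def)
  have sys': "is_system r' V' c' \<mu>'"
  proof -
    have "nondegenerate r' V'"
      using sys f(3) f(4)[of r] by (simp add: is_system_def nondegenerate_def)
    moreover have "c' (i + 1) \<le> c' i \<and> set_pmf (\<mu>' i) \<subseteq> V' i \<inter> cube" if i: "i \<in> {1..r'}" for i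
    proof (cases "i \<in> f ` {0..r}")
      case True
      from hit[OF this i] obtain j where j: "j \<in> {1..r}" "i = f j" by blast
      then show ?thesis
        using sys True by (simp add: c'_def \<mu>'_def g_f g_Suc_f f(4) is_system_def)
    next
      case False
      then show ?thesis
        using i vec.subspace_0[OF flag_subspace[OF flag', of i]]
        by (simp add: c'_def \<mu>'_def g_Suc cube_facts)
    qed
    ultimately show ?thesis
      using sys flag' inj span c1 cr by (simp add: is_system_def cube_spanned_def)
  qed
  have energy: "energy r' c' \<mu>' W = energy r c \<mu> (W \<circ> f)" for W
  proof -
    let ?t = "\<lambda>i. (c' i - c' (i + 1)) * (coset_entropy (\<mu>' i) (W i) + real (vec.dim (W i)))"
    have "inj_on f {1..r}"
      using strict_mono_on_imp_inj_on[OF f(1)] by (rule inj_on_subset) auto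
    have "(\<Sum>i=1..r'. ?t i) = (\<Sum>i\<in>f ` {1..r}. ?t i)"
    proof (intro sum.mono_neutral_right ballI)
      fix i assume "i \<in> {1..r'} - f ` {1..r}"
      then have "i \<notin> f ` {0..r}" using hit by blast
      then show "?t i = 0" by (simp add: c'_def g_Suc)
    qed (use f_range in auto)
    also have "\<dots> = (\<Sum>j=1..r. ?t (f j))"
      using \<open>inj_on f {1..r}\<close> by (simp add: sum.reindex)
    also have "\<dots> = (\<Sum>j=1..r. (c j - c (j + 1)) *
        (coset_entropy (\<mu> j) (W (f j)) + real (vec.dim (W (f j)))))"
      by (intro sum.cong refl) (simp add: c'_def \<mu>'_def g_f g_Suc_f)
    finally show ?thesis using c1 cr f(2,3) by (simp add: energy_by_parts)
  qed
  have "weak_entropy r' V' c' \<mu>'"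
    unfolding weak_entropy_def
  proof (intro allI impI)
    fix W assume "subflag r' W V'"
    then have "energy r c \<mu> V \<le> energy r c \<mu> (W \<circ> f)"
      using weak refined_subflag[of r f r' V' V, OF f] by (simp add: weak_entropy_def)
    moreover have "energy r c \<mu> (V' \<circ> f) = energy r c \<mu> V"
      using f(4) by (intro energy_cong) simp
    ultimately show "energy r' c' \<mu>' V' \<le> energy r' c' \<mu>' W" by (simp add: energy)
  qed
  with sys' show ?thesis using cr by (rule that)
qed

section \<open>Mixing systems on the same flag\<close>

text \<open>The measures of the two systems must be mixed in proportion to the weights that they carry in the
  energy, that is \<open>(1 - t) (c j - c (j + 1))\<close> and \<open>t (d j - d (j + 1))\<close>; concavity of entropy then
  bounds the mixed energy from below by the mixture of the energies.\<close>

lemma mix_weak_strict: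
  assumes sys: "is_system r V c \<mu>" and weak: "weak_entropy r V c \<mu>"
    and sys': "is_system r V d \<nu>" and strict: "strict_entropy r V d \<nu>"
    and t: "0 < t" "t \<le> 1"
  obtains c' \<mu>' where "is_system r V c' \<mu>'" "strict_entropy r V c' \<mu>'"
    "c' (r + 1) = (1 - t) * c (r + 1) + t * d (r + 1)"
proof -
  define c' where "c' j = (1 - t) * c j + t * d j" for j
  (* If both weights vanish, this is 0 / 0 = 0 and the mixing proportion is irrelevant. *)
  define s where "s j = t * (d j - d (j + 1)) / (c' j - c' (j + 1))" for j
  define \<mu>' where "\<mu>' j = mix_pmf (s j) (\<mu> j) (\<nu> j)" for j
  have step: "0 \<le> (1 - t) * (c j - c (j + 1))" "0 \<le> t * (d j - d (j + 1))"
    "c' j - c' (j + 1) = (1 - t) * (c j - c (j + 1)) + t * (d j - d (j + 1))" if "j \<in> {1..r}" for j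
  proof -
    have "c (j + 1) \<le> c j" "d (j + 1) \<le> d j" using sys sys' that by (simp_all add: is_system_def)
    then show "0 \<le> (1 - t) * (c j - c (j + 1))" "0 \<le> t * (d j - d (j + 1))" using t by simp_all
  qed (simp add: c'_def algebra_simps)
  have s: "0 \<le> s j" "s j \<le> 1" "(c' j - c' (j + 1)) * s j = t * (d j - d (j + 1))"
    "(c' j - c' (j + 1)) * (1 - s j) = (1 - t) * (c j - c (j + 1))" if "j \<in> {1..r}" for j
  proof -
    note st = step[OF that]
    show "0 \<le> s j" "s j \<le> 1" using st by (auto simp: s_def divide_le_eq_1)
    show *: "(c' j - c' (j + 1)) * s j = t * (d j - d (j + 1))"
    proof (cases "c' j - c' (j + 1) = 0")
      case True
      with st have "t * (d j - d (j + 1)) = 0" by linarith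
      with True show ?thesis by simp
    qed (simp add: s_def)
    show "(c' j - c' (j + 1)) * (1 - s j) = (1 - t) * (c j - c (j + 1))"
      using * st(3) by (simp add: right_diff_distrib)
  qed
  have supp: "set_pmf (\<mu>' j) \<subseteq> V j \<inter> cube" if "j \<in> {1..r}" for j
    using sys sys' that set_mix_pmf[of "s j" "\<mu> j" "\<nu> j"] unfolding is_system_def \<mu>'_def by blast
  have "is_system r V c' \<mu>'"
  proof -
    have "c' 1 \<le> (1 - t) * 1 + t * 1"
      unfolding c'_def using sys sys' t by (intro add_mono mult_left_mono) (auto simp: is_system_def)
    moreover have "c' (j + 1) \<le> c' j" if "j \<in> {1..r}" for j
      using step[OF that] by simp
    moreover have "0 \<le> c' (r + 1)" using sys sys' t by (simp add: is_system_def c'_def)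
    ultimately show ?thesis using sys supp by (simp add: is_system_def)
  qed
  moreover have "strict_entropy r V c' \<mu>'"
    unfolding strict_entropy_def
  proof (intro allI impI)
    fix W assume W: "subflag r W V \<and> (\<exists>j\<le>r. W j \<noteq> V j)"
    let ?D = "\<lambda>X j. real (vec.dim (X j)) - real (vec.dim (X (j - 1)))"
    have dims: "(\<Sum>j=1..r. c' j * ?D X j) = (1 - t) * (\<Sum>j=1..r. c j * ?D X j) + t * (\<Sum>j=1..r. d j * ?D X j)"
      for X
      unfolding sum_distrib_left sum.distrib[symmetric] by (intro sum.cong refl) (simp add: c'_def algebra_simps)
    have sub: "vec.subspace (V j)" "vec.subspace (W j)" if "j \<in> {1..r}" for j
      using sys W that by (auto simp: is_system_def subflag_def intro: flag_subspace)
    have "energy r c \<mu> V = (\<Sum>j=1..r. c j * ?D V j)" "energy r d \<nu> V = (\<Sum>j=1..r. d j * ?D V j)"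
      "energy r c' \<mu>' V = (\<Sum>j=1..r. c' j * ?D V j)"
      using sys sys' supp
      by (simp_all add: energy_def coset_entropy_eq_0[OF sub(1)] is_system_def)
    then have "energy r c' \<mu>' V = (1 - t) * energy r c \<mu> V + t * energy r d \<nu> V"
      by (simp only: dims)
    also have "\<dots> < (1 - t) * energy r c \<mu> W + t * energy r d \<nu> W"
    proof (rule add_le_less_mono)
      show "(1 - t) * energy r c \<mu> V \<le> (1 - t) * energy r c \<mu> W"
        using weak W t by (intro mult_left_mono) (auto simp: weak_entropy_def)
      show "t * energy r d \<nu> V < t * energy r d \<nu> W"
        using strict W t by (simp add: strict_entropy_def)
    qed
    also have "\<dots> \<le> energy r c' \<mu>' W"
    proof -
      have "(1 - t) * ((c j - c (j + 1)) * coset_entropy (\<mu> j) (W j)) +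
          t * ((d j - d (j + 1)) * coset_entropy (\<nu> j) (W j))
          \<le> (c' j - c' (j + 1)) * coset_entropy (\<mu>' j) (W j)" if j: "j \<in> {1..r}" for j
      proof -
        have "(1 - t) * ((c j - c (j + 1)) * coset_entropy (\<mu> j) (W j)) +
            t * ((d j - d (j + 1)) * coset_entropy (\<nu> j) (W j)) =
            (c' j - c' (j + 1)) * ((1 - s j) * coset_entropy (\<mu> j) (W j) + s j * coset_entropy (\<nu> j) (W j))"
          by (simp only: distrib_left mult.assoc[symmetric] s(3,4)[OF j])
        also have "\<dots> \<le> (c' j - c' (j + 1)) * coset_entropy (\<mu>' j) (W j)"
          unfolding \<mu>'_def using step[OF j] s[OF j] sub[OF j]
          by (intro mult_left_mono coset_entropy_concave) auto
        finally show ?thesis .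
      qed
      then have "(\<Sum>j=1..r. (1 - t) * ((c j - c (j + 1)) * coset_entropy (\<mu> j) (W j)) +
          t * ((d j - d (j + 1)) * coset_entropy (\<nu> j) (W j)))
          \<le> (\<Sum>j=1..r. (c' j - c' (j + 1)) * coset_entropy (\<mu>' j) (W j))"
        by (rule sum_mono)
      then show ?thesis
        unfolding energy_def dims by (simp only: sum.distrib sum_distrib_left[symmetric] distrib_left)
    qed
    finally show "energy r c' \<mu>' V < energy r c' \<mu>' W" .
  qed
  ultimately show ?thesis by (rule that) (simp add: c'_def)
qed

section \<open>Approximation by strict systems\<close>

theorem weak_system_approximated_by_strict:
  fixes V :: "nat \<Rightarrow> (rat ^ 'k::finite) set"
  assumes sys: "is_system r V c \<mu>" and weak: "weak_entropy r V c \<mu>" and "0 < \<epsilon>"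
  obtains r' V' c' \<mu>' where "refinement r V r' V'" "complete_flag r' V'"
    "is_system r' V' c' \<mu>'" "strict_entropy r' V' c' \<mu>'" "c' (r' + 1) > c (r + 1) - \<epsilon>"
proof -
  have "flag r V" "inj_on V {0..r}" "\<And>j. j \<le> r \<Longrightarrow> cube_spanned (V j)"
    using sys by (auto simp: is_system_def cube_spanned_def)
  then obtain r' V' where V': "refinement r V r' V'" "complete_flag r' V'" "\<And>i. cube_spanned (V' i)"
    using exists_complete_cube_refinement by blast
  obtain b \<beta> where b: "is_system r' V' b \<beta>" "weak_entropy r' V' b \<beta>" "b (r' + 1) = c (r + 1)"
    using weak_system_refine[OF sys weak V'(1) complete_flag_inj_on[OF V'(2)] V'(3)] by blast
  have "nondegenerate r' V'" using b(1) by (simp add: is_system_def)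
  then obtain d \<nu> where d: "is_system r' V' d \<nu>" "strict_entropy r' V' d \<nu>"
    using complete_cube_flag_supports_strict_system[OF V'(2,3)] by blast
  define e where "e = c (r + 1)"
  (* The strict system has a nonnegative endpoint, so mixing costs at most t * e < \<epsilon>. *)
  define t where "t = \<epsilon> / (\<epsilon> + e)"
  have e: "0 \<le> e" using sys by (simp add: is_system_def e_def)
  have t: "0 < t" "t \<le> 1" using e \<open>0 < \<epsilon>\<close> by (auto simp: t_def)
  obtain c' \<mu>' where c': "is_system r' V' c' \<mu>'" "strict_entropy r' V' c' \<mu>'"
    "c' (r' + 1) = (1 - t) * b (r' + 1) + t * d (r' + 1)"
    using mix_weak_strict[OF b(1,2) d t] .
  have "t * e < \<epsilon>" using e \<open>0 < \<epsilon>\<close> by (simp add: t_def field_simps)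
  moreover have "0 \<le> t * d (r' + 1)" using t d(1) by (simp add: is_system_def)
  ultimately have "c' (r' + 1) > c (r + 1) - \<epsilon>"
    unfolding c'(3) b(3) e_def by (simp add: left_diff_distrib)
  with V'(1,2) c'(1,2) show ?thesis by (rule that)
qed

lemma endpoint_le_1:
  assumes "is_system r V c \<mu>"
  shows "c (r + 1) \<le> 1"
proof -
  have "c (j + 1) \<le> 1" if "j \<le> r" for j
    using that
  proof (induction j)
    case (Suc j)
    then have "c (Suc j + 1) \<le> c (Suc j)" using assms unfolding is_system_def by force
    with Suc show ?case by simp
  qed (use assms in \<open>simp add: is_system_def\<close>)
  then show ?thesis by simp
qed

lemma strict_imp_weak_entropy: "strict_entropy r V c \<mu> \<Longrightarrow> weak_entropy r V c \<mu>"
  unfolding strict_entropy_def weak_entropy_def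
proof (intro allI impI)
  fix W
  assume strict: "\<forall>W. subflag r W V \<and> (\<exists>j\<le>r. W j \<noteq> V j) \<longrightarrow> energy r c \<mu> V < energy r c \<mu> W"
    and W: "subflag r W V"
  show "energy r c \<mu> V \<le> energy r c \<mu> W"
  proof (cases "\<exists>j\<le>r. W j \<noteq> V j")
    case False
    then have "energy r c \<mu> W = energy r c \<mu> V" by (intro energy_cong) simp
    then show ?thesis by simp
  qed (use strict W in force)
qed

theorem strict_threshold_eq_weak_threshold:
  "strict_threshold TYPE('k::finite) = weak_threshold TYPE('k)"
proof -
  define A where "A = {c (r + 1) | r c (V :: nat \<Rightarrow> (rat ^ 'k) set) \<mu>.
     is_system r V c \<mu> \<and> strict_entropy r V c \<mu>}"
  define B where "B = {c (r + 1) | r c (V :: nat \<Rightarrow> (rat ^ 'k) set) \<mu>.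
     is_system r V c \<mu> \<and> weak_entropy r V c \<mu>}"
  have sub: "A \<subseteq> B" unfolding A_def B_def using strict_imp_weak_entropy by blast
  have "bdd_above B" by (rule bdd_aboveI[of _ 1]) (auto simp: B_def dest: endpoint_le_1)
  have approx: "\<exists>a\<in>A. a > b - \<epsilon>" if b: "b \<in> B" and \<epsilon>: "0 < \<epsilon>" for b \<epsilon>
  proof -
    from b obtain r c and V :: "nat \<Rightarrow> (rat ^ 'k) set" and \<mu> where
      sys: "b = c (r + 1)" "is_system r V c \<mu>" "weak_entropy r V c \<mu>" by (auto simp: B_def)
    obtain r' V' c' \<mu>' where "refinement r V r' V'" "complete_flag r' V'"
      and strict: "is_system r' V' c' \<mu>'" "strict_entropy r' V' c' \<mu>'" "c' (r' + 1) > c (r + 1) - \<epsilon>"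
      by (rule weak_system_approximated_by_strict[OF sys(2,3) \<epsilon>])
    have "c' (r' + 1) \<in> A"
      unfolding A_def using strict(1,2)
      by (intro CollectI exI[of _ r'] exI[of _ c'] exI[of _ V'] exI[of _ \<mu>']) simp
    with strict(3) show ?thesis unfolding sys(1) by (intro bexI)
  qed
  have "Sup A = Sup B"
  proof (cases "B = {}")
    case True
    with sub show ?thesis by simp
  next
    case False
    then have "A \<noteq> {}" using approx[of _ 1] by fastforce
    have "bdd_above A" using \<open>bdd_above B\<close> sub by (rule bdd_above_mono)
    show ?thesis
    proof (rule antisym)
      show "Sup A \<le> Sup B" using \<open>A \<noteq> {}\<close> \<open>bdd_above B\<close> sub by (rule cSup_subset_mono)
      show "Sup B \<le> Sup A"
      proof (rule cSup_least[OF False])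
        fix b assume b: "b \<in> B"
        show "b \<le> Sup A"
        proof (rule field_le_epsilon)
          fix \<epsilon> :: real assume "0 < \<epsilon>"
          with approx[OF b] obtain a where "a \<in> A" "a > b - \<epsilon>" by blast
          moreover from this have "a \<le> Sup A" using \<open>bdd_above A\<close> by (intro cSup_upper)
          ultimately show "b \<le> Sup A + \<epsilon>" by simp
        qed
      qed
    qed
  qed
  then show ?thesis by (simp add: strict_threshold_def weak_threshold_def A_def B_def)
qed

theorem theorem4:
  assumes "CARD('k::finite) \<ge> 2"
  shows "(\<forall>r (V :: nat \<Rightarrow> (rat ^ 'k) set) c \<mu>.
            is_system r V c \<mu> \<and> weak_entropy r V c \<mu> \<longrightarrow>
            (\<forall>\<epsilon>>0. \<exists>r' V' c' \<mu>'. refinement r V r' V' \<and> complete_flag r' V' \<and>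
               is_system r' V' c' \<mu>' \<and> strict_entropy r' V' c' \<mu>' \<and>
               c' (r' + 1) > c (r + 1) - \<epsilon>)) \<and>
         strict_threshold TYPE('k) = weak_threshold TYPE('k)"
proof (intro conjI allI impI)
  fix r :: nat and V :: "nat \<Rightarrow> (rat ^ 'k) set" and c \<mu> and \<epsilon> :: real
  assume "is_system r V c \<mu> \<and> weak_entropy r V c \<mu>" and "0 < \<epsilon>"
  then obtain r' V' c' \<mu>' where "refinement r V r' V'" "complete_flag r' V'"
    "is_system r' V' c' \<mu>'" "strict_entropy r' V' c' \<mu>'" "c' (r' + 1) > c (r + 1) - \<epsilon>"
    using weak_system_approximated_by_strict[of r V c \<mu> \<epsilon>] by blast
  then show "\<exists>r' V' c' \<mu>'. refinement r V r' V' \<and> complete_flag r' V' \<and>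
      is_system r' V' c' \<mu>' \<and> strict_entropy r' V' c' \<mu>' \<and> c' (r' + 1) > c (r + 1) - \<epsilon>"
    by blast
qed (rule strict_threshold_eq_weak_threshold)

end
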